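(* Let $t\geq 1$ and let $m\geq 3$ be odd. Let $G$ be isomorphic to $D_{2^{t+1}m}$ or $Q_{2^{t+1}m}$, and let $\Gamma=\mathcal{E}_c^-(G)$. Then $M_1(\Gamma)=2^{3t}m(m-1)^2$ and $M_2(\Gamma)=2^{4t-1}m(m-1)^3$. Further, $\frac{M_2(\Gamma)}{|e(\Gamma)|}=2^{2t}(m-1)^2=\frac{M_1(\Gamma)}{|v(\Gamma)|}$.
   Context: For elements $x,y$ of a group, $[x,y]=x^{-1}y^{-1}xy$, $[x,{}_1y]=[x,y]$ and $[x,{}_{k+1}y]=[[x,{}_ky],y]$ for $k\ge 1$. For a finite group $G$ with Fitting subgroup $F(G)$, $\mathcal{E}_c^-(G)$ is the simple undirected graph with vertex set $G\setminus F(G)$ in which distinct $x,y$ are adjacent iff $[x,{}_ky]\neq 1$ and $[y,{}_kx]\neq 1$ for all positive integers $k$. $D_{2n}$ is the dihedral group of order $2n$; $Q_{2^{t+1}m}=\langle x,y\mid y^{2^tm}=1,\ x^2=y^{2^{t-1}m},\ xyx^{-1}=y^{-1}\rangle$ (order $2^{t+1}m$). For a finite simple graph $\Gamma$ with vertex set $v(\Gamma)$ and edge set $e(\Gamma)$, the first and second Zagreb indices are $M_1(\Gamma)=\sum_{v\in v(\Gamma)}\deg(v)^2$ and $M_2(\Gamma)=\sum_{uv\in e(\Gamma)}\deg(u)\deg(v)$. *)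

theory Defs
  imports "HOL-Algebra.Algebra"
begin

section \<open>Engel commutators and the Fitting subgroup\<close>

definition commutator :: "('a, 'b) monoid_scheme \<Rightarrow> 'a \<Rightarrow> 'a \<Rightarrow> 'a" where
  "commutator G x y = inv\<^bsub>G\<^esub> x \<otimes>\<^bsub>G\<^esub> inv\<^bsub>G\<^esub> y \<otimes>\<^bsub>G\<^esub> x \<otimes>\<^bsub>G\<^esub> y"

text \<open>The value at \<open>k \<ge> 1\<close> is \<open>[x, \<^sub>k y]\<close>; the value \<open>x\<close> at \<open>0\<close> only starts the recursion.\<close>
primrec engel_commutator :: "('a, 'b) monoid_scheme \<Rightarrow> 'a \<Rightarrow> 'a \<Rightarrow> nat \<Rightarrow> 'a" where
  "engel_commutator G x y 0 = x"
| "engel_commutator G x y (Suc k) = commutator G (engel_commutator G x y k) y"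

primrec lower_central_series :: "('a, 'b) monoid_scheme \<Rightarrow> nat \<Rightarrow> 'a set" where
  "lower_central_series G 0 = carrier G"
| "lower_central_series G (Suc n) =
     generate G {commutator G x y | x y. x \<in> lower_central_series G n \<and> y \<in> carrier G}"

definition nilpotent_group :: "('a, 'b) monoid_scheme \<Rightarrow> bool" where
  "nilpotent_group G \<longleftrightarrow> group G \<and> (\<exists>n. lower_central_series G n = {\<one>\<^bsub>G\<^esub>})"

text \<open>For finite \<open>G\<close> this is the largest nilpotent normal subgroup.\<close>
definition fitting_subgroup :: "('a, 'b) monoid_scheme \<Rightarrow> 'a set" where
  "fitting_subgroup G = generate G (\<Union>{N. N \<lhd> G \<and> nilpotent_group (G\<lparr>carrier := N\<rparr>)})"


section \<open>Simple graphs and Zagreb indices\<close>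

text \<open>Edges are two-element sets of vertices.\<close>
record 'a simple_graph =
  vertices :: "'a set"
  edges :: "'a set set"

definition vertex_degree :: "'a simple_graph \<Rightarrow> 'a \<Rightarrow> nat" where
  "vertex_degree \<Gamma> v = card {w \<in> vertices \<Gamma>. {v, w} \<in> edges \<Gamma>}"

definition zagreb1 :: "'a simple_graph \<Rightarrow> nat" where
  "zagreb1 \<Gamma> = (\<Sum>v\<in>vertices \<Gamma>. (vertex_degree \<Gamma> v)\<^sup>2)"

text \<open>The product over an edge \<open>{u, v}\<close> is \<open>vertex_degree \<Gamma> u * vertex_degree \<Gamma> v\<close>, because \<open>u \<noteq> v\<close>.\<close>
definition zagreb2 :: "'a simple_graph \<Rightarrow> nat" where
  "zagreb2 \<Gamma> = (\<Sum>e\<in>edges \<Gamma>. \<Prod>v\<in>e. vertex_degree \<Gamma> v)"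

definition engel_graph :: "('a, 'b) monoid_scheme \<Rightarrow> 'a simple_graph" where
  "engel_graph G =
    \<lparr>vertices = carrier G - fitting_subgroup G,
     edges = {{x, y} | x y. x \<in> carrier G - fitting_subgroup G \<and>
       y \<in> carrier G - fitting_subgroup G \<and> x \<noteq> y \<and>
       (\<forall>k\<ge>1. engel_commutator G x y k \<noteq> \<one>\<^bsub>G\<^esub> \<and> engel_commutator G y x k \<noteq> \<one>\<^bsub>G\<^esub>)}\<rparr>"


section \<open>Groups given by generators and relations\<close>

text \<open>A letter \<open>(g, True)\<close> stands for the generator \<open>g\<close>, and \<open>(g, False)\<close> for its inverse.
  A relation \<open>u = v\<close> is the pair \<open>(u, v)\<close> of words.\<close>
type_synonym 'g word = "('g \<times> bool) list"

inductive_set word_cong :: "('g word \<times> 'g word) set \<Rightarrow> ('g word \<times> 'g word) set"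
  for R :: "('g word \<times> 'g word) set" where
  refl: "(u, u) \<in> word_cong R"
| sym: "(u, v) \<in> word_cong R \<Longrightarrow> (v, u) \<in> word_cong R"
| trans: "(u, v) \<in> word_cong R \<Longrightarrow> (v, w) \<in> word_cong R \<Longrightarrow> (u, w) \<in> word_cong R"
| append: "(u, v) \<in> word_cong R \<Longrightarrow> (u', v') \<in> word_cong R \<Longrightarrow> (u @ u', v @ v') \<in> word_cong R"
| cancel: "([(g, b), (g, \<not> b)], []) \<in> word_cong R"
| relation: "(u, v) \<in> R \<Longrightarrow> (u, v) \<in> word_cong R"

definition presented_group :: "('g word \<times> 'g word) set \<Rightarrow> 'g word set monoid" where
  "presented_group R =
    \<lparr>carrier = UNIV // word_cong R,
     monoid.mult = (\<lambda>A B. \<Union>u\<in>A. \<Union>v\<in>B. word_cong R `` {u @ v}),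
     monoid.one = word_cong R `` {[]}\<rparr>"

lemma equiv_word_cong: "equiv UNIV (word_cong R)"
  by (rule equivI) (auto simp: refl_on_def sym_def trans_def
      intro: word_cong.refl word_cong.sym word_cong.trans)

lemma presented_group_mult:
  "word_cong R `` {u} \<otimes>\<^bsub>presented_group R\<^esub> word_cong R `` {v} = word_cong R `` {u @ v}"
proof -
  have "congruent2 (word_cong R) (word_cong R) (\<lambda>u v. word_cong R `` {u @ v})"
    by (rule congruent2I')
      (auto intro!: equiv_class_eq[OF equiv_word_cong] word_cong.append)
  then show ?thesis
    using UN_equiv_class2[OF equiv_word_cong equiv_word_cong]
    by (simp add: presented_group_def)
qed

lemma word_cong_left_inverse: "\<exists>v. (v @ u, []) \<in> word_cong R"
proof (induction u)
  case Nil
  then show ?case using word_cong.refl by (metis append_Nil)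
next
  case (Cons a u)
  obtain v where v: "(v @ u, []) \<in> word_cong R" using Cons by blast
  obtain g b where a: "a = (g, b)" by (cases a)
  have "([(g, \<not> b), (g, b)], []) \<in> word_cong R"
    using word_cong.cancel[of g "\<not> b" R] by simp
  from word_cong.append[OF word_cong.append[OF word_cong.refl[of v] this] word_cong.refl[of u]]
  have "((v @ [(g, \<not> b)]) @ a # u, v @ u) \<in> word_cong R" by (simp add: a)
  then show ?case using v word_cong.trans by blast
qed

lemma group_presented_group: "group (presented_group R)"
proof (rule groupI)
  have cls: "\<exists>u. A = word_cong R `` {u}" if "A \<in> carrier (presented_group R)" for A
    using that by (auto simp: presented_group_def elim: quotientE)
  have mem: "word_cong R `` {u} \<in> carrier (presented_group R)" for u
    by (simp add: presented_group_def quotientI)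
  have one: "\<one>\<^bsub>presented_group R\<^esub> = word_cong R `` {[]}"
    by (simp add: presented_group_def)
  show "\<one>\<^bsub>presented_group R\<^esub> \<in> carrier (presented_group R)"
    by (simp add: one mem)
  fix A B C
  assume A: "A \<in> carrier (presented_group R)"
  obtain u where u: "A = word_cong R `` {u}" using cls[OF A] by blast
  show "\<one>\<^bsub>presented_group R\<^esub> \<otimes>\<^bsub>presented_group R\<^esub> A = A"
    by (simp add: one u presented_group_mult)
  obtain v where "(v @ u, []) \<in> word_cong R" using word_cong_left_inverse by blast
  then have "word_cong R `` {v} \<otimes>\<^bsub>presented_group R\<^esub> A = \<one>\<^bsub>presented_group R\<^esub>"
    by (simp add: one u presented_group_mult equiv_class_eq[OF equiv_word_cong])
  then show "\<exists>B\<in>carrier (presented_group R). B \<otimes>\<^bsub>presented_group R\<^esub> A = \<one>\<^bsub>presented_group R\<^esub>"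
    using mem by blast
  assume B: "B \<in> carrier (presented_group R)"
  obtain w where w: "B = word_cong R `` {w}" using cls[OF B] by blast
  show "A \<otimes>\<^bsub>presented_group R\<^esub> B \<in> carrier (presented_group R)"
    by (simp add: u w presented_group_mult mem)
  assume C: "C \<in> carrier (presented_group R)"
  obtain z where z: "C = word_cong R `` {z}" using cls[OF C] by blast
  show "A \<otimes>\<^bsub>presented_group R\<^esub> B \<otimes>\<^bsub>presented_group R\<^esub> C =
      A \<otimes>\<^bsub>presented_group R\<^esub> (B \<otimes>\<^bsub>presented_group R\<^esub> C)"
    by (simp add: u w z presented_group_mult)
qed

datatype two_gens = GenX | GenY

text \<open>The relation \<open>x y x\<^sup>-\<^sup>1 = y\<^sup>-\<^sup>1\<close>.\<close>
definition inversion_relation :: "two_gens word \<times> two_gens word" where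
  "inversion_relation = ([(GenX, True), (GenY, True), (GenX, False)], [(GenY, False)])"

text \<open>\<open>dihedral_group n\<close> is \<open>\<langle>x, y | y\<^sup>n = 1, x\<^sup>2 = 1, x y x\<^sup>-\<^sup>1 = y\<^sup>-\<^sup>1\<rangle>\<close>, of order \<open>2n\<close>;
  the index is half the order.\<close>
definition dihedral_group :: "nat \<Rightarrow> two_gens word set monoid" where
  "dihedral_group n = presented_group
    {(replicate n (GenY, True), []),
     (replicate 2 (GenX, True), []),
     inversion_relation}"

text \<open>The group \<open>Q\<close> of order \<open>2\<^bsup>t+1\<^esup>m\<close>, for \<open>t \<ge> 1\<close>.\<close>
definition quaternion_group :: "nat \<Rightarrow> nat \<Rightarrow> two_gens word set monoid" where
  "quaternion_group t m = presented_group
    {(replicate (2 ^ t * m) (GenY, True), []),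
     (replicate 2 (GenX, True), replicate (2 ^ (t - 1) * m) (GenY, True)),
     inversion_relation}"

end

theory Submission
  imports Defs
begin

text \<open>Both groups are unions of the cyclic group \<open>\<langle>y\<rangle>\<close> of order \<open>n = 2\<^sup>t m\<close> and the coset \<open>x\<langle>y\<rangle>\<close>, whose
  elements invert \<open>y\<close>. Since \<open>[y\<^sup>i, x y\<^sup>j] = y\<close> to the power \<open>-2i\<close>, a normal subgroup meeting \<open>x\<langle>y\<rangle>\<close> is not
  nilpotent, so the Fitting subgroup is \<open>\<langle>y\<rangle>\<close>. The same formula shows that the \<open>k\<close>-th Engel commutator
  of \<open>x y\<^sup>i\<close> and \<open>x y\<^sup>j\<close> is \<open>y\<close> to the power \<open>(-2)\<^sup>k (i - j)\<close>; it vanishes for some \<open>k\<close> iff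
  \<open>m\<close> divides \<open>i - j\<close>. The graph is therefore complete multipartite with \<open>m\<close> parts of size \<open>2\<^sup>t\<close>, hence
  regular of degree \<open>2\<^sup>t (m - 1)\<close>. That the presentations do not collapse follows from a
  two-dimensional complex representation.\<close>

section \<open>Regular graphs and congruence counting\<close>

text \<open>Since \<open>w \<mapsto> {v, w}\<close> matches neighbours of \<open>v\<close> with
  edges through \<open>v\<close>, double counting the incident pairs gives the handshake identity;
  both Zagreb sums have constant terms.\<close>

lemma zagreb_regular_graph:
  assumes V: "finite (vertices \<Gamma>)"
    and E: "\<And>e. e \<in> edges \<Gamma> \<Longrightarrow> e \<subseteq> vertices \<Gamma> \<and> card e = 2"
    and deg: "\<And>v. v \<in> vertices \<Gamma> \<Longrightarrow> vertex_degree \<Gamma> v = d"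
  shows "zagreb1 \<Gamma> = card (vertices \<Gamma>) * d\<^sup>2"
    and "2 * card (edges \<Gamma>) = card (vertices \<Gamma>) * d"
    and "zagreb2 \<Gamma> = card (edges \<Gamma>) * d\<^sup>2"
proof -
  show "zagreb1 \<Gamma> = card (vertices \<Gamma>) * d\<^sup>2"
    by (simp add: zagreb1_def deg)
  have "(\<Prod>v\<in>e. vertex_degree \<Gamma> v) = d\<^sup>2" if "e \<in> edges \<Gamma>" for e
    using E[OF that] deg by (subst prod.cong[OF HOL.refl, of _ _ "\<lambda>_. d"]) auto
  then show "zagreb2 \<Gamma> = card (edges \<Gamma>) * d\<^sup>2"
    by (simp add: zagreb2_def)
  have finE: "finite (edges \<Gamma>)"
    using E V by (auto intro: finite_subset[of _ "Pow (vertices \<Gamma>)"])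
  have "bij_betw (\<lambda>w. {v, w}) {w \<in> vertices \<Gamma>. {v, w} \<in> edges \<Gamma>} {e \<in> edges \<Gamma>. v \<in> e}" for v
  proof -
    have "\<exists>w\<in>vertices \<Gamma>. e = {v, w}" if "e \<in> edges \<Gamma>" "v \<in> e" for e
      using E[OF that(1)] that(2) by (auto simp: card_2_iff)
    then show ?thesis
      by (auto simp: bij_betw_def inj_on_def doubleton_eq_iff image_iff)
  qed
  then have "card {e \<in> edges \<Gamma>. v \<in> e} = d" if "v \<in> vertices \<Gamma>" for v
    using bij_betw_same_card[of _ _ "{e \<in> edges \<Gamma>. v \<in> e}"] deg[OF that]
    unfolding vertex_degree_def by fastforce
  moreover have "(\<Sum>v\<in>vertices \<Gamma>. card {e \<in> edges \<Gamma>. v \<in> e}) = 2 * card (edges \<Gamma>)"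
  proof (rule sum_multicount[OF V finE], intro ballI)
    fix e assume e: "e \<in> edges \<Gamma>"
    then have "{v \<in> vertices \<Gamma>. v \<in> e} = e" using E by blast
    then show "card {v \<in> vertices \<Gamma>. v \<in> e} = 2" using E e by simp
  qed
  ultimately show "2 * card (edges \<Gamma>) = card (vertices \<Gamma>) * d" by simp
qed

text \<open>With \<open>a = 2 ^ t\<close> this is the size of a part of the multipartite graph. The
  residue class of \<open>i\<close> is parametrised by \<open>k * m + r\<close>, with inverse
  \<open>j div m\<close>.\<close>

lemma card_lessThan_cong_int:
  assumes "0 < m"
  shows "card {j. j < a * m \<and> int m dvd i - int j} = a"
proof -
  define r where "r = nat (i mod int m)"
  have r: "int r = i mod int m" "r < m" using assms by (auto simp: r_def nat_less_iff)
  have dvd: "int m dvd i - int j \<longleftrightarrow> j mod m = r" for j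
  proof -
    have "int m dvd i - int j \<longleftrightarrow> int r = int (j mod m)"
      unfolding mod_eq_dvd_iff[symmetric] r(1) zmod_int ..
    then show ?thesis by auto
  qed
  have "bij_betw (\<lambda>k. k * m + r) {..<a} {j. j < a * m \<and> j mod m = r}"
  proof (rule bij_betwI[where g = "\<lambda>j. j div m"])
    have "k * m + r < a * m" if "k < a" for k
    proof -
      have "k * m + r < Suc k * m" using r by simp
      also have "\<dots> \<le> a * m" using that by (intro mult_le_mono) auto
      finally show ?thesis .
    qed
    then show "(\<lambda>k. k * m + r) \<in> {..<a} \<rightarrow> {j. j < a * m \<and> j mod m = r}"
      using r by auto
    show "(\<lambda>j. j div m) \<in> {j. j < a * m \<and> j mod m = r} \<rightarrow> {..<a}"
      using assms by (auto simp: less_mult_imp_div_less)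
  qed (use assms r in \<open>auto simp: div_mult_mod_eq\<close>)
  then have "card {j. j < a * m \<and> j mod m = r} = a"
    using bij_betw_same_card by force
  then show ?thesis by (simp add: dvd)
qed

lemma dvd_power_two_mult_iff:
  assumes "odd m"
  shows "(\<exists>k\<ge>1. int (2 ^ t * m) dvd (- 2) ^ k * i) \<longleftrightarrow> int m dvd i"
proof
  assume "\<exists>k\<ge>1. int (2 ^ t * m) dvd (- 2) ^ k * i"
  then obtain k where "int (2 ^ t * m) dvd (- 2) ^ k * i" by blast
  then have "int m dvd (- 2) ^ k * i" by (metis dvd_mult_right of_nat_mult)
  moreover have "coprime (int m) ((- 2) ^ k)" using assms by simp
  ultimately show "int m dvd i" by (simp add: coprime_dvd_mult_right_iff)
next
  assume "int m dvd i"
  \<comment> \<open>Exponent \<open>t\<close> already supplies the factor \<open>2 ^ t\<close>;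
    \<open>Suc t\<close> also satisfies \<open>k \<ge> 1\<close> when \<open>t = 0\<close>.\<close>
  then have "int (2 ^ t * m) dvd (- 2) ^ Suc t * i"
    by (simp add: mult_dvd_mono power_minus[of 2])
  then show "\<exists>k\<ge>1. int (2 ^ t * m) dvd (- 2) ^ k * i" by (metis One_nat_def Suc_le_mono le0)
qed

section \<open>Engel commutators when \<open>x\<close> inverts \<open>y\<close>\<close>

locale inverting_pair = group G for G (structure) +
  fixes x y
  assumes x [simp, intro]: "x \<in> carrier G" and y [simp, intro]: "y \<in> carrier G"
    and conj: "x \<otimes> y \<otimes> inv x = inv y"
begin

abbreviation rot :: "int \<Rightarrow> 'a" where "rot i \<equiv> y [^] i"
abbreviation flip :: "int \<Rightarrow> 'a" where "flip i \<equiv> x \<otimes> y [^] i"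

text \<open>Conjugation by \<open>x\<close> is an endomorphism, so inverting \<open>y\<close> it
  inverts every power of \<open>y\<close>.\<close>

lemma rot_x: "rot i \<otimes> x = x \<otimes> rot (- i)"
proof -
  have "(\<lambda>a. x \<otimes> a \<otimes> inv x) \<in> hom G G"
    by (rule homI) (simp_all add: m_assoc inv_solve_left flip: m_assoc[of "inv x"])
  from hom_int_pow[OF this y, of "- i"] have "x \<otimes> rot (- i) \<otimes> inv x = rot i"
    by (simp add: conj int_pow_inv int_pow_neg is_group)
  then show ?thesis by (simp add: inv_solve_right')
qed

lemma rot_rot: "rot i \<otimes> rot j = rot (i + j)"
  by (simp add: int_pow_mult)

lemma rot_flip: "rot i \<otimes> flip j = flip (j - i)"
  using rot_x by (simp add: m_assoc[symmetric]) (simp add: m_assoc rot_rot)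

lemma flip_rot: "flip i \<otimes> rot j = flip (i + j)"
  by (simp add: m_assoc rot_rot)

lemma flip_flip: "flip i \<otimes> flip j = x \<otimes> x \<otimes> rot (j - i)"
  by (simp add: m_assoc rot_flip)

text \<open>\<open>[a, b]\<close> is \<open>a^-1\<close> times the conjugate
  \<open>b^-1 a b\<close>, and here that conjugate is again \<open>a^-1\<close>.\<close>

lemma commutator_rot_flip: "commutator G (rot i) (flip j) = rot (- 2 * i)"
proof -
  have "rot i \<otimes> flip j = flip j \<otimes> rot (- i)" by (simp only: rot_flip flip_rot) simp
  then have "inv (flip j) \<otimes> (rot i \<otimes> flip j) = rot (- i)" by (simp add: inv_solve_left')
  moreover have "commutator G (rot i) (flip j) = rot (- i) \<otimes> (inv (flip j) \<otimes> (rot i \<otimes> flip j))"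
    by (simp add: commutator_def m_assoc int_pow_neg)
  ultimately show ?thesis by (simp add: rot_rot)
qed

text \<open>Both products of the two flips are \<open>x \<otimes> x\<close> times a power of
  \<open>y\<close>, so \<open>x \<otimes> x\<close> cancels and its value does not enter.\<close>

lemma commutator_flip_flip: "commutator G (flip i) (flip j) = rot (- 2 * (i - j))"
proof -
  have "flip i \<otimes> flip j = flip j \<otimes> flip i \<otimes> rot (2 * (j - i))"
    by (simp only: flip_flip) (simp add: m_assoc rot_rot)
  then have "inv (flip j \<otimes> flip i) \<otimes> (flip i \<otimes> flip j) = rot (2 * (j - i))"
    by (simp add: inv_solve_left' m_assoc del: inv_mult_group)
  then show ?thesis
    by (simp add: commutator_def m_assoc inv_mult_group algebra_simps)
qed

text \<open>The first commutator lands among the powers of \<open>y\<close>; each later one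
  multiplies the exponent by \<open>-2\<close>.\<close>

lemma engel_commutator_flip:
  "engel_commutator G (flip i) (flip j) (Suc k) = rot ((- 2) ^ Suc k * (i - j))"
proof (induction k)
  case 0
  show ?case by (simp only: engel_commutator.simps commutator_flip_flip) simp
next
  case (Suc k)
  show ?case by (subst engel_commutator.simps) (simp only: Suc commutator_rot_flip, simp add: algebra_simps)
qed

text \<open>This is the induction step for bringing a word to the form \<open>y^i\<close> or
  \<open>x y^i\<close>, reading its letters from the right.\<close>

lemma generator_mult_closed:
  assumes sq: "x \<otimes> x = rot c" and a: "a \<in> {x, inv x, y, inv y}"
    and b: "b \<in> range rot \<union> range flip"
  shows "a \<otimes> b \<in> range rot \<union> range flip"
proof -
  have x_flip: "x \<otimes> flip i = rot (c + i)" for i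
    by (simp add: m_assoc[symmetric] sq rot_rot)
  have "inv x \<otimes> rot i = flip (i - c)" for i
    by (subst inv_solve_left') (auto simp: x_flip)
  moreover have "inv x \<otimes> flip i = rot i" for i
    by (subst inv_solve_left') auto
  moreover have "y \<otimes> rot i = rot (1 + i)" "y \<otimes> flip i = flip (i - 1)"
    "inv y \<otimes> rot i = rot (- 1 + i)" "inv y \<otimes> flip i = flip (i + 1)" for i
    using rot_rot[of 1 i] rot_flip[of 1 i] rot_rot[of "- 1" i] rot_flip[of "- 1" i]
    by (simp_all add: int_pow_neg)
  ultimately show ?thesis using a b x_flip by fastforce
qed

end

text \<open>What both families share, in terms that survive isomorphism: \<open>y\<close> has order
  exactly \<open>2 ^ t * m\<close>, and its powers form a subgroup of index 2. The value of
  \<open>x \<otimes> x\<close> stays open.\<close>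

locale inverted_cyclic = inverting_pair G x y for G (structure) and x y +
  fixes t m :: nat
  assumes odd_m: "odd m" and m_ge_3: "m \<ge> 3"
    and pow_eq_one: "rot i = \<one> \<longleftrightarrow> int (2 ^ t * m) dvd i"
    and x_notin: "x \<notin> range rot"
    and carrier_eq: "carrier G = range rot \<union> range flip"
begin

lemma rot_eq_iff: "rot i = rot j \<longleftrightarrow> int (2 ^ t * m) dvd i - j"
proof -
  have "rot i = rot j \<longleftrightarrow> rot i \<otimes> inv (rot j) = \<one>"
    using inv_solve_right[of \<one> "rot i" "rot j"] by auto
  then show ?thesis by (simp only: pow_eq_one[symmetric] int_pow_diff y)
qed

lemma flip_eq_iff: "flip i = flip j \<longleftrightarrow> int (2 ^ t * m) dvd i - j"
  by (simp add: rot_eq_iff)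

lemma flip_neq_rot: "flip i \<noteq> rot j"
proof
  assume "flip i = rot j"
  then have "x = rot (j - i)"
    by (simp add: int_pow_diff inv_solve_right)
  then show False using x_notin by blast
qed

lemma engel_flip_iff:
  "(\<exists>k\<ge>1. engel_commutator G (flip i) (flip j) k = \<one>) \<longleftrightarrow> int m dvd i - j"
proof -
  have "(k \<ge> 1 \<and> engel_commutator G (flip i) (flip j) k = \<one>) \<longleftrightarrow>
      (k \<ge> 1 \<and> int (2 ^ t * m) dvd (- 2) ^ k * (i - j))" for k
    by (cases k) (simp_all only: engel_commutator_flip pow_eq_one, simp_all)
  then show ?thesis using dvd_power_two_mult_iff[OF odd_m] by simp
qed

section \<open>The Fitting subgroup\<close>

lemma subgroup_rot: "subgroup (range rot) G"
  by (rule subgroupI) (auto simp: rot_rot int_pow_neg[symmetric])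

lemma normal_rot: "range rot \<lhd> G"
proof -
  have "g \<otimes> rot i \<otimes> inv g \<in> range rot" if "g \<in> carrier G" for g i
  proof -
    from that consider j where "g = rot j" | j where "g = flip j" using carrier_eq by auto
    then show ?thesis
    proof cases
      case 1
      then show ?thesis by (simp add: int_pow_neg[symmetric] rot_rot)
    next
      case 2
      have "flip j \<otimes> rot i = rot (- i) \<otimes> flip j" by (simp only: rot_flip flip_rot) simp
      then have "flip j \<otimes> rot i \<otimes> inv (flip j) = rot (- i)" by (simp add: inv_solve_right')
      then show ?thesis using 2 by simp
    qed
  qed
  then show ?thesis using subgroup_rot by (auto simp: normal_inv_iff)
qed

lemma nilpotent_rot: "nilpotent_group (G\<lparr>carrier := range rot\<rparr>)"
proof -
  interpret A: group "G\<lparr>carrier := range rot\<rparr>" by (rule subgroup_imp_group[OF subgroup_rot])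
  let ?c = "commutator (G\<lparr>carrier := range rot\<rparr>)"
  have "?c (rot i) (rot j) = \<one>" for i j
    by (simp add: commutator_def subgroup_rot int_pow_neg[symmetric] rot_rot)
  moreover have "{?c a b | a b. a \<in> range rot \<and> b \<in> range rot} = {?c (rot i) (rot j) | i j. True}"
    by blast
  ultimately have "{?c a b | a b. a \<in> range rot \<and> b \<in> range rot} = {\<one>}"
    by simp
  then have "lower_central_series (G\<lparr>carrier := range rot\<rparr>) (Suc 0) = {\<one>}"
    using A.generate_one by simp
  then show ?thesis unfolding nilpotent_group_def using A.is_group by fastforce
qed

lemma normal_nilpotent_subset_rot:
  assumes N: "N \<lhd> G" and nil: "nilpotent_group (G\<lparr>carrier := N\<rparr>)"
  shows "N \<subseteq> range rot"
proof (rule ccontr)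
  assume "\<not> N \<subseteq> range rot"
  interpret N: normal N G by fact
  have sub: "subgroup N G" by (rule N.is_subgroup)
  obtain i where i: "flip i \<in> N"
    using \<open>\<not> N \<subseteq> range rot\<close> N.subset carrier_eq by blast
  \<comment> \<open>Conjugating \<open>x y^i\<close> by \<open>y\<close> gives
    \<open>x y^(i-2)\<close>; comparing the two elements of \<open>N\<close> yields
    \<open>y^(-2)\<close>.\<close>
  have "rot 1 \<otimes> flip i \<otimes> inv (rot 1) \<in> N"
    using N.inv_op_closed2[OF _ i] by (metis int_pow_closed y)
  also have "rot 1 \<otimes> flip i \<otimes> inv (rot 1) = flip i \<otimes> rot (- 2)"
    by (simp only: rot_flip flip_rot int_pow_neg[OF y, symmetric]) simp
  finally have "inv (flip i) \<otimes> (flip i \<otimes> rot (- 2)) \<in> N"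
    using i by blast
  also have "inv (flip i) \<otimes> (flip i \<otimes> rot (- 2)) = rot (- 2)"
    by (subst inv_solve_left') auto
  finally have base: "rot (- 2) \<in> N" .
  \<comment> \<open>Commutation with \<open>flip i\<close> keeps doubling the exponent, up to sign.
    Membership in \<open>N\<close> is carried along because commutators in \<open>N\<close> and in
    \<open>G\<close> agree only for elements of \<open>N\<close>.\<close>
  have "rot ((- 2) ^ Suc k) \<in> lower_central_series (G\<lparr>carrier := N\<rparr>) k \<and> rot ((- 2) ^ Suc k) \<in> N" for k
  proof (induction k)
    case 0
    show ?case using base by simp
  next
    case (Suc k)
    have eq: "rot ((- 2) ^ Suc (Suc k)) = commutator G (rot ((- 2) ^ Suc k)) (flip i)"
      by (simp only: commutator_rot_flip) simp
    also have "\<dots> = commutator (G\<lparr>carrier := N\<rparr>) (rot ((- 2) ^ Suc k)) (flip i)"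
      using Suc i sub by (simp add: commutator_def)
    finally have "rot ((- 2) ^ Suc (Suc k)) \<in> lower_central_series (G\<lparr>carrier := N\<rparr>) (Suc k)"
      using Suc i by (auto intro!: generate.incl)
    moreover have "rot ((- 2) ^ Suc (Suc k)) \<in> N"
      unfolding eq commutator_def using Suc i by (auto intro!: N.m_closed N.m_inv_closed simp del: power_Suc)
    ultimately show ?case by blast
  qed
  moreover obtain k where "lower_central_series (G\<lparr>carrier := N\<rparr>) k = {\<one>}"
    using nil unfolding nilpotent_group_def by auto
  ultimately have "rot ((- 2) ^ Suc k) = \<one>" by blast
  \<comment> \<open>The factor \<open>1\<close> casts this as the divisibility criterion with
    \<open>i = 1\<close>, which forces \<open>m\<close> to divide \<open>1\<close>.\<close>
  then have "int (2 ^ t * m) dvd (- 2) ^ Suc k * 1" by (simp only: pow_eq_one) simp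
  then have "int m dvd 1" using dvd_power_two_mult_iff[OF odd_m, of t 1] by (metis One_nat_def Suc_le_mono le0)
  then show False using m_ge_3 by simp
qed

lemma fitting_subgroup_eq: "fitting_subgroup G = range rot"
proof -
  have "\<Union>{N. N \<lhd> G \<and> nilpotent_group (G\<lparr>carrier := N\<rparr>)} = range rot"
    using normal_nilpotent_subset_rot normal_rot nilpotent_rot by blast
  then show ?thesis
    unfolding fitting_subgroup_def using generateI[OF subgroup_rot, of "range rot"] by simp
qed

section \<open>Vertices, edges and degrees of the Engel graph\<close>

lemma vertices_eq: "carrier G - fitting_subgroup G = flip ` int ` {..<2 ^ t * m}"
proof -
  have "carrier G - fitting_subgroup G = range flip"
    using flip_neq_rot by (auto simp: carrier_eq fitting_subgroup_eq)
  also have "\<dots> = flip ` int ` {..<2 ^ t * m}"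
  proof -
    have "flip i \<in> flip ` int ` {..<2 ^ t * m}" for i
    proof -
      let ?j = "nat (i mod int (2 ^ t * m))"
      have pos: "int (2 ^ t * m) > 0" using m_ge_3 by simp
      then have j: "int ?j = i mod int (2 ^ t * m)" by simp
      have "int (2 ^ t * m) dvd i - int ?j" unfolding j by (rule dvd_minus_mod)
      then have "flip i = flip (int ?j)" by (simp only: flip_eq_iff)
      moreover have "?j < 2 ^ t * m" using pos by (subst nat_less_iff) (auto simp del: of_nat_mult)
      ultimately show ?thesis by blast
    qed
    then show ?thesis by blast
  qed
  finally show ?thesis .
qed

lemma inj_flip: "inj_on (\<lambda>j. flip (int j)) {..<2 ^ t * m}"
proof (rule inj_onI)
  fix i j :: nat
  assume ij: "i \<in> {..<2 ^ t * m}" "j \<in> {..<2 ^ t * m}" "flip (int i) = flip (int j)"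
  then have "int i mod int (2 ^ t * m) = int j mod int (2 ^ t * m)"
    by (simp only: flip_eq_iff mod_eq_dvd_iff)
  then show "i = j" using ij by (simp only: zmod_int[symmetric] of_nat_eq_iff mod_less lessThan_iff)
qed

lemma engel_graph_edge_iff:
  assumes "a \<in> carrier G - fitting_subgroup G" "b \<in> carrier G - fitting_subgroup G"
  shows "{a, b} \<in> edges (engel_graph G) \<longleftrightarrow> a \<noteq> b \<and>
    \<not> (\<exists>k\<ge>1. engel_commutator G a b k = \<one>) \<and> \<not> (\<exists>k\<ge>1. engel_commutator G b a k = \<one>)"
  using assms unfolding engel_graph_def simple_graph.simps mem_Collect_eq doubleton_eq_iff by blast

lemma flip_edge_iff:
  assumes "i < 2 ^ t * m" "j < 2 ^ t * m"
  shows "{flip (int i), flip (int j)} \<in> edges (engel_graph G) \<longleftrightarrow> \<not> int m dvd int i - int j"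
proof -
  have V: "flip (int i) \<in> carrier G - fitting_subgroup G" "flip (int j) \<in> carrier G - fitting_subgroup G"
    using assms unfolding vertices_eq by blast+
  have "{flip (int i), flip (int j)} \<in> edges (engel_graph G) \<longleftrightarrow>
      flip (int i) \<noteq> flip (int j) \<and>
      \<not> (\<exists>k\<ge>1. engel_commutator G (flip (int i)) (flip (int j)) k = \<one>) \<and>
      \<not> (\<exists>k\<ge>1. engel_commutator G (flip (int j)) (flip (int i)) k = \<one>)"
    by (rule engel_graph_edge_iff[OF V])
  also have "\<dots> \<longleftrightarrow> \<not> int m dvd int i - int j"
    \<comment> \<open>The two Engel conditions coincide because divisibility ignores sign, and they
      imply distinctness: equal flips have exponents congruent modulo \<open>2 ^ t * m\<close>,
      hence modulo \<open>m\<close>.\<close>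
    unfolding engel_flip_iff flip_eq_iff by (auto simp: dvd_diff_commute dest: dvd_mult_right)
  finally show ?thesis .
qed

lemma vertices_engel_graph: "vertices (engel_graph G) = (\<lambda>j. flip (int j)) ` {..<2 ^ t * m}"
  by (simp add: engel_graph_def vertices_eq image_image)

text \<open>The vertices not adjacent to \<open>x y^i\<close>, itself included, are the
  \<open>2 ^ t\<close> ones whose exponent is congruent to \<open>i\<close> modulo
  \<open>m\<close>.\<close>

lemma vertex_degree_engel_graph:
  assumes "v \<in> vertices (engel_graph G)"
  shows "vertex_degree (engel_graph G) v = 2 ^ t * (m - 1)"
proof -
  obtain i where i: "i < 2 ^ t * m" "v = flip (int i)"
    using assms vertices_engel_graph by auto
  let ?J = "{j. j < 2 ^ t * m \<and> int m dvd int i - int j}"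
  have "{w \<in> vertices (engel_graph G). {v, w} \<in> edges (engel_graph G)} =
      (\<lambda>j. flip (int j)) ` ({..<2 ^ t * m} - ?J)"
    using i flip_edge_iff unfolding vertices_engel_graph by blast
  then have "vertex_degree (engel_graph G) v = card ({..<2 ^ t * m} - ?J)"
    unfolding vertex_degree_def using inj_flip by (simp add: card_image inj_on_diff)
  also have "\<dots> = 2 ^ t * m - card ?J"
    by (subst card_Diff_subset) (auto intro: finite_subset[of _ "{..<2 ^ t * m}"])
  also have "\<dots> = 2 ^ t * (m - 1)"
    using m_ge_3 by (simp add: card_lessThan_cong_int diff_mult_distrib2)
  finally show ?thesis .
qed

lemma edges_engel_graph:
  assumes "e \<in> edges (engel_graph G)"
  shows "e \<subseteq> vertices (engel_graph G) \<and> card e = 2"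
  using assms unfolding engel_graph_def simple_graph.simps mem_Collect_eq
  by (elim exE conjE) (simp only: card_2_iff insert_subset empty_subsetI, blast)

lemma zagreb_engel_graph:
  shows "card (vertices (engel_graph G)) = 2 ^ t * m"
    and "2 * card (edges (engel_graph G)) = 2 ^ t * m * (2 ^ t * (m - 1))"
    and "zagreb1 (engel_graph G) = 2 ^ t * m * (2 ^ t * (m - 1))\<^sup>2"
    and "zagreb2 (engel_graph G) = card (edges (engel_graph G)) * (2 ^ t * (m - 1))\<^sup>2"
proof -
  have fin: "finite (vertices (engel_graph G))" by (simp add: vertices_engel_graph)
  show V: "card (vertices (engel_graph G)) = 2 ^ t * m"
    using inj_flip by (simp add: vertices_engel_graph card_image)
  note regular = zagreb_regular_graph[OF fin edges_engel_graph vertex_degree_engel_graph, unfolded V]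
  show "2 * card (edges (engel_graph G)) = 2 ^ t * m * (2 ^ t * (m - 1))"
    by (rule regular(2))
  show "zagreb1 (engel_graph G) = 2 ^ t * m * (2 ^ t * (m - 1))\<^sup>2"
    by (rule regular(1))
  show "zagreb2 (engel_graph G) = card (edges (engel_graph G)) * (2 ^ t * (m - 1))\<^sup>2"
    by (rule regular(3))
qed

end

section \<open>Transport along isomorphisms\<close>

text \<open>Injectivity of \<open>h\<close> preserves the order of \<open>y\<close> and keeps
  \<open>x\<close> outside its powers; surjectivity gives the carrier.\<close>

lemma inverted_cyclic_iso:
  assumes "inverted_cyclic G x y t m" and h: "h \<in> iso G H" and "group H"
  shows "inverted_cyclic H (h x) (h y) t m"
proof -
  interpret G: inverted_cyclic G x y t m by fact
  interpret H: group H by fact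
  interpret h: group_hom G H h
    using h by unfold_locales (simp add: iso_def)
  have inj: "inj_on h (carrier G)" and surj: "h ` carrier G = carrier H"
    using h by (auto simp: iso_def bij_betw_def)
  have rot: "h y [^]\<^bsub>H\<^esub> i = h (G.rot i)" for i :: int
    by (simp add: h.hom_int_pow)
  show ?thesis
  proof (unfold_locales; (unfold rot)?)
    show "h x \<otimes>\<^bsub>H\<^esub> h y \<otimes>\<^bsub>H\<^esub> inv\<^bsub>H\<^esub> h x = inv\<^bsub>H\<^esub> h y"
      using arg_cong[OF G.conj, of h] by simp
    show "h (G.rot i) = \<one>\<^bsub>H\<^esub> \<longleftrightarrow> int (2 ^ t * m) dvd i" for i
      using inj_on_eq_iff[OF inj, of "G.rot i" "\<one>\<^bsub>G\<^esub>"] G.pow_eq_one by simp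
    show "h x \<notin> range (\<lambda>i. h (G.rot i))"
      using G.x_notin inj_on_eq_iff[OF inj G.x] by fastforce
    show "carrier H = range (\<lambda>i. h (G.rot i)) \<union> range (\<lambda>i. h x \<otimes>\<^bsub>H\<^esub> h (G.rot i))"
      unfolding surj[symmetric] G.carrier_eq image_Un image_image by simp
  qed (use G.odd_m G.m_ge_3 in auto)
qed

section \<open>The presented groups and their action on complex pairs\<close>

text \<open>The parameter \<open>c\<close> merges the two families: \<open>c = 0\<close> is
  dihedral, \<open>c = n / 2\<close> is quaternion, and in both cases \<open>n\<close> divides
  \<open>2 * c\<close>.\<close>

definition inversion_presentation :: "nat \<Rightarrow> nat \<Rightarrow> (two_gens word \<times> two_gens word) set" where
  "inversion_presentation n c =
    {(replicate n (GenY, True), []),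
     (replicate 2 (GenX, True), replicate c (GenY, True)),
     inversion_relation}"

lemma dihedral_group_eq: "dihedral_group n = presented_group (inversion_presentation n 0)"
  by (simp add: dihedral_group_def inversion_presentation_def)

lemma quaternion_group_eq:
  "quaternion_group t m = presented_group (inversion_presentation (2 ^ t * m) (2 ^ (t - 1) * m))"
  by (simp add: quaternion_group_def inversion_presentation_def)

text \<open>For \<open>\<zeta>\<close> a primitive \<open>n\<close>-th root of unity and \<open>n\<close> dividing \<open>2 c\<close> this is the representation of the
  group of \<open>inversion_presentation n c\<close> induced from the character \<open>y \<mapsto> \<zeta>\<close>. The second equation gives the
  inverse of the first only because \<open>\<zeta> ^ c\<close> is then \<open>1\<close> or \<open>-1\<close>.\<close>
fun letter_action :: "complex \<Rightarrow> nat \<Rightarrow> two_gens \<times> bool \<Rightarrow> complex \<times> complex \<Rightarrow> complex \<times> complex" where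
  "letter_action \<zeta> c (GenX, True) (z, w) = (w, \<zeta> ^ c * z)"
| "letter_action \<zeta> c (GenX, False) (z, w) = (\<zeta> ^ c * w, z)"
| "letter_action \<zeta> c (GenY, True) (z, w) = (\<zeta> * z, inverse \<zeta> * w)"
| "letter_action \<zeta> c (GenY, False) (z, w) = (inverse \<zeta> * z, \<zeta> * w)"

lemma funpow_letter_action_GenY:
  "(letter_action \<zeta> c (GenY, True) ^^ k) (z, w) = (\<zeta> ^ k * z, inverse \<zeta> ^ k * w)"
  by (induction k) (simp_all add: algebra_simps)

text \<open>The letters act compatibly with the relations, so words with different actions are
  different group elements.\<close>

lemma foldr_letter_action_cong:
  assumes "(u, v) \<in> word_cong (inversion_presentation n c)"
    and \<zeta>: "\<zeta> \<noteq> 0" "\<zeta> ^ n = 1" "\<zeta> ^ (2 * c) = 1"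
  shows "foldr (letter_action \<zeta> c) u p = foldr (letter_action \<zeta> c) v p"
  using assms(1)
proof (induction arbitrary: p rule: word_cong.induct)
  case (cancel g b)
  have [simp]: "\<zeta> ^ c * (\<zeta> ^ c * a) = a" for a
    using \<zeta>(3) by (simp add: mult.assoc[symmetric] power_add[symmetric] mult_2)
  show ?case by (cases g; cases b; cases p) (simp_all add: \<zeta>)
next
  case (relation u v)
  have sq [simp]: "\<zeta> ^ c * (\<zeta> ^ c * a) = a" for a
    using \<zeta>(3) by (simp add: mult.assoc[symmetric] power_add[symmetric] mult_2)
  \<comment> \<open>On the second coordinate \<open>x^2\<close> acts by \<open>\<zeta> ^ c\<close>
    but \<open>y^c\<close> by \<open>inverse \<zeta> ^ c\<close>.\<close>
  have "inverse \<zeta> ^ c = \<zeta> ^ c"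
    using sq[of 1] by (metis inverse_unique mult.right_neutral power_inverse)
  then show ?case
    using relation \<zeta>(2) by (cases p)
      (auto simp: inversion_presentation_def inversion_relation_def
        funpow_letter_action_GenY numeral_2_eq_2 power_inverse)
qed simp_all

lemma cis_power_eq_one_iff:
  assumes "n > 0"
  shows "cis (2 * pi / real n) ^ k = 1 \<longleftrightarrow> n dvd k"
proof -
  let ?\<zeta> = "cis (2 * pi / real n)"
  have n: "?\<zeta> ^ n = 1" using assms by (simp add: DeMoivre)
  have "?\<zeta> ^ k = ?\<zeta> ^ (n * (k div n) + k mod n)" by simp
  also have "\<dots> = ?\<zeta> ^ (k mod n)" by (simp only: power_add power_mult n) simp
  also have "\<dots> = 1 \<longleftrightarrow> k mod n = 0"
  proof -
    have "inj_on (\<lambda>k. cis (2 * pi * real k / real n)) {..<n}"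
      using bij_betw_roots_unity[OF assms] by (simp add: bij_betw_def)
    from inj_on_eq_iff[OF this, of "k mod n" 0] show ?thesis
      using assms by (simp add: DeMoivre mult.commute)
  qed
  finally show ?thesis by (simp add: dvd_eq_mod_eq_0)
qed

text \<open>The relations bound the group from above: \<open>y^n = 1\<close>, and every word reduces
  to \<open>y^i\<close> or \<open>x y^i\<close>. The action on pairs shows that nothing further
  collapses.\<close>

lemma inverted_cyclic_presented_group:
  assumes m: "odd m" "m \<ge> 3" and c: "2 ^ t * m dvd 2 * c"
  defines "R \<equiv> inversion_presentation (2 ^ t * m) c"
  shows "inverted_cyclic (presented_group R) (word_cong R `` {[(GenX, True)]})
    (word_cong R `` {[(GenY, True)]}) t m"
proof -
  let ?P = "presented_group R" and ?n = "2 ^ t * m"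
  define cls where "cls = (\<lambda>u. word_cong R `` {u})"
  define gx gy where "gx = cls [(GenX, True)]" and "gy = cls [(GenY, True)]"
  define \<zeta> where "\<zeta> = cis (2 * pi / real ?n)"
  interpret P: group ?P by (rule group_presented_group)
  have n: "?n > 0" using m by simp
  have \<zeta>: "\<zeta> ^ k = 1 \<longleftrightarrow> ?n dvd k" for k
    unfolding \<zeta>_def by (rule cis_power_eq_one_iff[OF n])
  have act: "foldr (letter_action \<zeta> c) u p = foldr (letter_action \<zeta> c) v p" if "cls u = cls v" for u v p
  proof (rule foldr_letter_action_cong)
    show "(u, v) \<in> word_cong (inversion_presentation ?n c)"
      using that eq_equiv_class_iff[OF equiv_word_cong] unfolding cls_def R_def by blast
    show "\<zeta> \<noteq> 0" by (simp add: \<zeta>_def)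
  qed (use \<zeta> c in simp_all)
  have cls_eqI: "cls u = cls v" if "(u, v) \<in> word_cong R" for u v
    using that equiv_class_eq[OF equiv_word_cong] unfolding cls_def by blast
  have cls [simp]: "cls u \<in> carrier ?P" for u
    by (simp add: cls_def presented_group_def quotientI)
  have mult: "cls u \<otimes>\<^bsub>?P\<^esub> cls v = cls (u @ v)" for u v
    by (simp add: cls_def presented_group_mult)
  have one: "\<one>\<^bsub>?P\<^esub> = cls []"
    by (simp add: cls_def presented_group_def)
  have inv: "inv\<^bsub>?P\<^esub> cls [(g, True)] = cls [(g, False)]" for g
  proof (rule P.inv_equality)
    show "cls [(g, False)] \<otimes>\<^bsub>?P\<^esub> cls [(g, True)] = \<one>\<^bsub>?P\<^esub>"
      using cls_eqI[OF word_cong.cancel[of g False]] by (simp add: mult one)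
  qed simp_all
  have pow: "gy [^]\<^bsub>?P\<^esub> k = cls (replicate k (GenY, True))" for k :: nat
    by (induction k) (simp_all add: one gy_def mult replicate_append_same)
  interpret P: inverting_pair ?P gx gy
  proof
    show "gx \<otimes>\<^bsub>?P\<^esub> gy \<otimes>\<^bsub>?P\<^esub> inv\<^bsub>?P\<^esub> gx = inv\<^bsub>?P\<^esub> gy"
      unfolding gx_def gy_def inv mult
      by (rule cls_eqI) (simp add: word_cong.relation R_def inversion_presentation_def inversion_relation_def)
  qed (simp_all add: gx_def gy_def)
  have "gy [^]\<^bsub>?P\<^esub> ?n = \<one>\<^bsub>?P\<^esub>"
    unfolding pow one
    by (rule cls_eqI) (simp add: word_cong.relation R_def inversion_presentation_def)
  then have n_one: "P.rot (int ?n) = \<one>\<^bsub>?P\<^esub>" by (simp only: int_pow_int)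
  \<comment> \<open>A nonnegative exponent turns a power of \<open>y\<close> into an explicit
    positive word, on which the action can be evaluated.\<close>
  have rot_mod: "\<exists>k::nat. int ?n dvd i - int k \<and> P.rot i = cls (replicate k (GenY, True))" for i
  proof (intro exI conjI)
    let ?k = "nat (i mod int ?n)"
    have k: "int ?k = i mod int ?n" using n by simp
    show "int ?n dvd i - int ?k" unfolding k by (rule dvd_minus_mod)
    have "P.rot i = P.rot (int ?n * (i div int ?n) + int ?k)" unfolding k by simp
    also have "\<dots> = P.rot (int ?k)"
      by (simp only: P.int_pow_mult P.y P.int_pow_pow[symmetric] n_one P.int_pow_one P.l_one P.int_pow_closed)
    finally show "P.rot i = cls (replicate ?k (GenY, True))" by (simp only: int_pow_int pow)
  qed
  have "inverted_cyclic ?P gx gy t m"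
  proof
    show "odd m" "m \<ge> 3" by fact+
    show "P.rot i = \<one>\<^bsub>?P\<^esub> \<longleftrightarrow> int ?n dvd i" for i
    proof
      assume i: "P.rot i = \<one>\<^bsub>?P\<^esub>"
      obtain k where k: "int ?n dvd i - int k" "P.rot i = cls (replicate k (GenY, True))"
        using rot_mod by blast
      then have "cls (replicate k (GenY, True)) = cls []" using i one by simp
      \<comment> \<open>The first coordinate of the image of \<open>(1, 1)\<close> is
        \<open>\<zeta> ^ k\<close>, which must be \<open>1\<close>.\<close>
      from act[OF this, of "(1, 1)"] have "?n dvd k"
        by (simp add: funpow_letter_action_GenY \<zeta>)
      then have "int ?n dvd int k" by (simp only: of_nat_dvd_iff)
      with k(1) show "int ?n dvd i" by (metis dvd_diffD1 dvd_diff_commute dvd_add_right_iff diff_add_cancel)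
    next
      assume "int ?n dvd i"
      then obtain j where "i = int ?n * j" by blast
      then show "P.rot i = \<one>\<^bsub>?P\<^esub>"
        by (simp only: P.int_pow_pow[symmetric] P.y n_one P.int_pow_one)
    qed
    show "gx \<notin> range P.rot"
    proof
      assume "gx \<in> range P.rot"
      then obtain k where "cls [(GenX, True)] = cls (replicate k (GenY, True))"
        using rot_mod unfolding gx_def by blast
      \<comment> \<open>\<open>x\<close> sends \<open>(1, 0)\<close> to
        \<open>(0, \<zeta> ^ c)\<close>, whereas powers of \<open>y\<close> keep its first
        coordinate nonzero.\<close>
      from act[OF this, of "(1, 0)"] show False
        by (simp add: funpow_letter_action_GenY \<zeta>_def)
    qed
    have sq: "gx \<otimes>\<^bsub>?P\<^esub> gx = P.rot (int c)"
      unfolding int_pow_int pow gx_def mult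
      by (rule cls_eqI) (simp add: word_cong.relation R_def inversion_presentation_def numeral_2_eq_2)
    have "cls u \<in> range P.rot \<union> range P.flip" for u
    proof (induction u)
      case Nil
      have "cls [] = P.rot 0" by (simp add: one)
      then show ?case by blast
    next
      case (Cons l u)
      have "cls [l] \<in> {gx, inv\<^bsub>?P\<^esub> gx, gy, inv\<^bsub>?P\<^esub> gy}"
        unfolding gx_def gy_def inv by (cases l rule: prod.exhaust; cases "fst l"; cases "snd l") auto
      from P.generator_mult_closed[OF sq this Cons] show ?case by (simp add: mult)
    qed
    then have "carrier ?P \<subseteq> range P.rot \<union> range P.flip"
      unfolding presented_group_def cls_def by (auto elim!: quotientE)
    then show "carrier ?P = range P.rot \<union> range P.flip" by auto
  qed
  then show ?thesis by (simp add: gx_def gy_def cls_def)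
qed

section \<open>Zagreb indices for the dihedral and quaternion groups\<close>

theorem theorem9p2:
  fixes G :: "('a, 'b) monoid_scheme" and t m :: nat
  assumes "group G"
    and "t \<ge> 1" and "m \<ge> 3" and "odd m"
    and "G \<cong> dihedral_group (2 ^ t * m) \<or> G \<cong> quaternion_group t m"
  shows "zagreb1 (engel_graph G) = 2 ^ (3 * t) * m * (m - 1)\<^sup>2 \<and>
    zagreb2 (engel_graph G) = 2 ^ (4 * t - 1) * m * (m - 1) ^ 3 \<and>
    real (zagreb2 (engel_graph G)) / real (card (edges (engel_graph G)))
           = 2 ^ (2 * t) * (real m - 1)\<^sup>2 \<and>
    real (zagreb1 (engel_graph G)) / real (card (vertices (engel_graph G)))
           = 2 ^ (2 * t) * (real m - 1)\<^sup>2"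
proof -
  have "2 * 2 ^ (t - 1) = (2 ^ t :: nat)"
    using assms(2) by (simp flip: power_Suc)
  then have "2 * (2 ^ (t - 1) * m) = 2 ^ t * m" by (simp flip: mult.assoc)
  \<comment> \<open>\<open>c\<close> is \<open>0\<close> in the dihedral case and
    \<open>2 ^ (t - 1) * m\<close> in the quaternion case.\<close>
  then obtain c where c: "2 ^ t * m dvd 2 * c"
    and "G \<cong> presented_group (inversion_presentation (2 ^ t * m) c)"
    using assms(5) unfolding dihedral_group_eq quaternion_group_eq by (metis dvd_0_right dvd_refl mult_0_right)
  then obtain h where "h \<in> iso (presented_group (inversion_presentation (2 ^ t * m) c)) G"
    using group.iso_sym[OF assms(1)] unfolding is_iso_def by blast
  from inverted_cyclic_iso[OF inverted_cyclic_presented_group[OF assms(4,3) c] this assms(1)]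
  obtain x y where "inverted_cyclic G x y t m" by blast
  then interpret inverted_cyclic G x y t m .
  let ?\<Gamma> = "engel_graph G" and ?d = "2 ^ t * (m - 1)"
  note V = zagreb_engel_graph(1) and E = zagreb_engel_graph(2)
    and M1 = zagreb_engel_graph(3) and M2 = zagreb_engel_graph(4)
  \<comment> \<open>The subtraction in \<open>?d\<close> is truncated; \<open>m \<ge> 3\<close>
    makes it agree with the real one.\<close>
  have d: "(real ?d)\<^sup>2 = 2 ^ (2 * t) * (real m - 1)\<^sup>2"
    using assms(3) by (simp add: of_nat_diff power_mult_distrib power_mult[symmetric] mult.commute)
  have "zagreb1 ?\<Gamma> = 2 ^ (3 * t) * m * (m - 1)\<^sup>2"
    unfolding M1 by (simp add: power_mult power_mult_distrib power2_eq_square power3_eq_cube mult_ac)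
  moreover have "zagreb2 ?\<Gamma> = 2 ^ (4 * t - 1) * m * (m - 1) ^ 3"
  proof -
    \<comment> \<open>The edge count is known only in doubled form, so the identity for the second
      index is doubled too; \<open>t \<ge> 1\<close> keeps \<open>4 * t - 1\<close> from
      truncating.\<close>
    have pow: "2 * 2 ^ (4 * t - 1) = (2 ^ t :: nat) ^ 4"
      using assms(2) by (simp flip: power_Suc power_mult add: mult.commute)
    have "2 * zagreb2 ?\<Gamma> = (2 * card (edges ?\<Gamma>)) * ?d\<^sup>2" by (simp add: M2)
    also have "\<dots> = (2 ^ t) ^ 4 * m * (m - 1) ^ 3"
      unfolding E by (simp add: power_mult_distrib power2_eq_square power3_eq_cube power4_eq_xxxx mult_ac)
    also have "\<dots> = 2 * (2 ^ (4 * t - 1) * m * (m - 1) ^ 3)" by (simp flip: pow)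
    finally show ?thesis by simp
  qed
  moreover have "real (zagreb2 ?\<Gamma>) / real (card (edges ?\<Gamma>)) = (real ?d)\<^sup>2"
  proof -
    \<comment> \<open>The quotient cancels the edge count, which must therefore be nonzero.\<close>
    have "2 * card (edges ?\<Gamma>) \<noteq> 0" unfolding E using assms(3) by simp
    then show ?thesis unfolding M2 by simp
  qed
  moreover have "real (zagreb1 ?\<Gamma>) / real (card (vertices ?\<Gamma>)) = (real ?d)\<^sup>2"
    unfolding M1 V using assms(3) by simp
  ultimately show ?thesis unfolding d by blast
qed

end
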